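(* Let $k\geq 2$ and $n\geq 2k$ be integers, and let $G$ be a simple graph of order $n$. If $\delta(G)\geq k$ and $$\mu(\overline{G})\leq\sqrt{(k-1)(n-k-1)},$$ then $G$ is Hamilton-connected, unless one of the following holds: $G=(K_{k-1}+K_{n-k-1})\vee K_2$; or $G=(K_{k-1}+K_{n-k-1})\vee O_2$; or $n=2k$ and $G\in ES_n$.
   Context: All graphs are finite and simple; equality of graphs is up to isomorphism. $\delta(G)$ is the minimum degree, $\overline{G}$ is the complement of $G$, and $\mu(\cdot)$ is the spectral radius, i.e. the largest eigenvalue of the adjacency matrix. $G_1+G_2$ denotes the disjoint union of graphs $G_1,G_2$, and $G_1\vee G_2$ denotes their join (the disjoint union together with all edges between $V(G_1)$ and $V(G_2)$). $K_m$ is the complete graph and $O_m$ the edgeless graph on $m$ vertices; $K_{a,b}$ is the complete bipartite graph. A graph is Hamilton-connected if every two distinct vertices are the endpoints of a Hamiltonian path. For even $n$, $ES_n$ is the set of the following graphs of order $n$: (i) $K_{\frac n2,\frac n2}$; (ii) $G_1\vee G_2$, where, for some integer $r$ with $1\leq r\leq \frac n2$, $G_1$ is a regular graph of order $n-r$ with degree $\frac n2-r$ and $G_2$ is any graph with $r$ vertices. *)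

theory Defs
  imports
    "Graph_Theory.Graph_Theory"
    "Jordan_Normal_Form.Spectral_Radius"
begin

text \<open>
  A finite simple graph is a \<open>pair_graph\<close>: a finite loop-free digraph without parallel arcs
  whose arc relation is symmetric, so that an edge between \<open>u\<close> and \<open>v\<close> is the pair of arcs
  \<open>(u, v)\<close> and \<open>(v, u)\<close>. Equality of graphs up to isomorphism is \<open>digraph_iso\<close>.
\<close>

definition graph_complement :: "'a pair_pre_digraph \<Rightarrow> 'a pair_pre_digraph" where
  "graph_complement G = \<lparr> pverts = pverts G,
     parcs = {(u, v). u \<in> pverts G \<and> v \<in> pverts G \<and> u \<noteq> v \<and> (u, v) \<notin> parcs G} \<rparr>"

text \<open>Since the arc relation is symmetric, the degree of a vertex is its out-degree.\<close>

definition min_degree :: "'a pair_pre_digraph \<Rightarrow> nat" where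
  "min_degree G = Min (out_degree (with_proj G) ` pverts G)"

definition regular_graph :: "nat \<Rightarrow> 'a pair_pre_digraph \<Rightarrow> bool" where
  "regular_graph d G \<longleftrightarrow> pair_graph G \<and> (\<forall>v \<in> pverts G. out_degree (with_proj G) v = d)"

definition adjacency_matrix :: "'a pair_pre_digraph \<Rightarrow> 'a list \<Rightarrow> real mat" where
  "adjacency_matrix G vs = mat (length vs) (length vs)
     (\<lambda>(i, j). if (vs ! i, vs ! j) \<in> parcs G then 1 else 0)"

definition vertex_enum :: "'a pair_pre_digraph \<Rightarrow> 'a list" where
  "vertex_enum G = (SOME vs. distinct vs \<and> set vs = pverts G)"

text \<open>
  The largest eigenvalue of the adjacency matrix. Reordering the vertices conjugates the
  matrix by a permutation matrix, so the value does not depend on the chosen enumeration.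
  For a graph with at least one vertex the set of real eigenvalues is finite and, the matrix
  being real symmetric, nonempty.
\<close>

definition graph_spectral_radius :: "'a pair_pre_digraph \<Rightarrow> real" where
  "graph_spectral_radius G = Max (spectrum (adjacency_matrix G (vertex_enum G)))"

definition disjoint_union :: "'a pair_pre_digraph \<Rightarrow> 'b pair_pre_digraph \<Rightarrow> ('a + 'b) pair_pre_digraph"
  where
  "disjoint_union G H = \<lparr> pverts = pverts G <+> pverts H,
     parcs = map_prod Inl Inl ` parcs G \<union> map_prod Inr Inr ` parcs H \<rparr>"

definition graph_join :: "'a pair_pre_digraph \<Rightarrow> 'b pair_pre_digraph \<Rightarrow> ('a + 'b) pair_pre_digraph"
  where
  "graph_join G H = \<lparr> pverts = pverts G <+> pverts H,
     parcs = parcs (disjoint_union G H)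
       \<union> (Inl ` pverts G) \<times> (Inr ` pverts H) \<union> (Inr ` pverts H) \<times> (Inl ` pverts G) \<rparr>"

definition complete_graph :: "nat \<Rightarrow> nat pair_pre_digraph" where
  "complete_graph m = \<lparr> pverts = {..<m}, parcs = {(i, j). i < m \<and> j < m \<and> i \<noteq> j} \<rparr>"

definition edgeless_graph :: "nat \<Rightarrow> nat pair_pre_digraph" where
  "edgeless_graph m = \<lparr> pverts = {..<m}, parcs = {} \<rparr>"

definition hamiltonian_path :: "'a pair_pre_digraph \<Rightarrow> 'a \<Rightarrow> ('a \<times> 'a) awalk \<Rightarrow> 'a \<Rightarrow> bool" where
  "hamiltonian_path G u p v \<longleftrightarrow>
     pre_digraph.apath (with_proj G) u p v \<and>
     set (pre_digraph.awalk_verts (with_proj G) u p) = pverts G"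

definition hamilton_connected :: "'a pair_pre_digraph \<Rightarrow> bool" where
  "hamilton_connected G \<longleftrightarrow>
     (\<forall>u \<in> pverts G. \<forall>v \<in> pverts G. u \<noteq> v \<longrightarrow> (\<exists>p. hamiltonian_path G u p v))"

text \<open>
  The family \<open>ES\<^sub>n\<close>, meant for even \<open>n\<close>. As graphs are taken up to isomorphism, it suffices to let
  the two parts of the join range over graphs whose vertices are natural numbers.
\<close>

definition ES :: "nat \<Rightarrow> (nat + nat) pair_pre_digraph set" where
  "ES n = {H. complete_bipartite_digraph (n div 2) (n div 2) (with_proj H)}
     \<union> {graph_join G\<^sub>1 G\<^sub>2 | G\<^sub>1 G\<^sub>2 r. 1 \<le> r \<and> r \<le> n div 2 \<and>
          regular_graph (n div 2 - r) G\<^sub>1 \<and> card (pverts G\<^sub>1) = n - r \<and>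
          pair_graph G\<^sub>2 \<and> card (pverts G\<^sub>2) = r}"

end

theory Submission
  imports Defs "HOL-Analysis.Function_Topology"
begin

text \<open>
  Suppose that \<open>G\<close> has no Hamiltonian path from \<open>a\<close> to \<open>b\<close>, and enlarge \<open>G\<close> to an edge-maximal graph
  \<open>H\<close> on the same vertices with this property. Let \<open>C\<close> and \<open>D \<subseteq> C\<close> be the edge sets of the complements
  of \<open>G\<close> and \<open>H\<close>. Ore's argument (\<open>ore_nonadjacent_degree_sum\<close>) bounds the degree sum in \<open>H\<close> of two
  nonadjacent vertices by \<open>n\<close>, and by \<open>n - 1\<close> if one of them is \<open>a\<close> or \<open>b\<close>. So the ends of every edge of
  \<open>D\<close> have degree sum at least \<open>n - 2\<close> in \<open>D\<close>, while all degrees are at most \<open>n - k - 1\<close>. It follows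
  that the product of the two degrees is at least \<open>(k - 1) * (n - k - 1)\<close>.

  The test vector of square roots of degrees (\<open>degree_weighted_test_vector\<close>) now shows that the
  spectral radius of \<open>C\<close> is at least the square root of this number. By hypothesis it is at most that,
  so equality holds everywhere: every edge of \<open>D\<close> joins vertices of degrees \<open>k - 1\<close> and \<open>n - k - 1\<close>,
  and the edges of \<open>C\<close> outside \<open>D\<close> run between vertices that are isolated in \<open>D\<close>. As the degree
  sums are then minimal, the strict form of Ore's bound makes \<open>a\<close> and \<open>b\<close> isolated in \<open>D\<close>.

  If \<open>n > 2 * k\<close>, the two degrees differ, and counting vertices identifies \<open>D\<close> as a complete bipartite
  graph on all vertices but \<open>a\<close> and \<open>b\<close> (\<open>two_degree_complete_bipartite\<close>); \<open>C\<close> may contain the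
  edge \<open>ab\<close> or not, which gives the two graphs \<open>(K\<^sub>k\<^sub>-\<^sub>1 + K\<^sub>n\<^sub>-\<^sub>k\<^sub>-\<^sub>1) \<or> K\<^sub>2\<close> and \<open>(K\<^sub>k\<^sub>-\<^sub>1 + K\<^sub>n\<^sub>-\<^sub>k\<^sub>-\<^sub>1) \<or> O\<^sub>2\<close>.
  If \<open>n = 2 * k\<close>, all vertices not isolated in \<open>D\<close> have degree \<open>k - 1\<close> in \<open>C\<close>, and \<open>G\<close> is the join of the
  regular graph that they induce with an arbitrary graph on the isolated vertices, which exist since
  \<open>a\<close> is one of them: \<open>G\<close> belongs to the second part of \<open>ES n\<close> (\<open>digraph_iso_ES\<close>). The balanced complete
  bipartite graph is covered by this description, as the join of two edgeless graphs.
\<close>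

section \<open>Rayleigh quotients\<close>

text \<open>
  First-order optimality: a one-variable quadratic with its minimum \<open>0\<close> at \<open>t = 0\<close> has no
  linear term.
\<close>

lemma quadratic_min_at_zero:
  fixes s q :: real
  assumes "\<And>t. 0 \<le> 2 * t * s + t\<^sup>2 * q"
  shows "s = 0"
proof (rule ccontr)
  assume s: "s \<noteq> 0"
  \<comment> \<open>This step against the sign of \<open>s\<close> is so short that the linear term beats \<open>t\<^sup>2 * q\<close>.\<close>
  define t where "t = - s / (\<bar>q\<bar> + 1)"
  have t: "t * (\<bar>q\<bar> + 1) = - s"
    by (simp add: t_def)
  have "0 \<le> (2 * t * s + t\<^sup>2 * q) * (\<bar>q\<bar> + 1)\<^sup>2"
    using assms[of t] by simp
  also have "\<dots> = 2 * (t * (\<bar>q\<bar> + 1)) * s * (\<bar>q\<bar> + 1) + (t * (\<bar>q\<bar> + 1))\<^sup>2 * q"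
    by (simp add: power2_eq_square algebra_simps)
  also have "\<dots> = - (s\<^sup>2 * (2 * (\<bar>q\<bar> + 1) - q))"
    unfolding t by (simp add: power2_eq_square algebra_simps)
  also have "\<dots> < 0"
    using s by (simp add: zero_less_mult_iff)
  finally show False by simp
qed

text \<open>
  The Rayleigh principle, without the spectral theorem. The quadratic form attains its maximum \<open>m\<close>
  on the unit sphere, which is compact as a closed subset of a product of compact intervals. Hence
  \<open>m * N y - B y y\<close> is nonnegative everywhere and vanishes at the maximiser \<open>x\<close>; its derivative at \<open>x\<close>
  in each coordinate direction is zero, which says that \<open>x\<close> is an eigenvector for \<open>m\<close>.
\<close>

lemma symmetric_form_max_eigenvalue:
  fixes a :: "'i \<Rightarrow> 'i \<Rightarrow> real"
  assumes fin: "finite I" and ne: "I \<noteq> {}"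
    and sym: "\<And>i j. i \<in> I \<Longrightarrow> j \<in> I \<Longrightarrow> a i j = a j i"
  obtains m x where "\<exists>i\<in>I. x i \<noteq> 0"
    and "\<And>i. i \<in> I \<Longrightarrow> (\<Sum>j\<in>I. a i j * x j) = m * x i"
    and "\<And>y. (\<Sum>i\<in>I. \<Sum>j\<in>I. a i j * y i * y j) \<le> m * (\<Sum>i\<in>I. (y i)\<^sup>2)"
proof -
  define B where "B y z = (\<Sum>i\<in>I. \<Sum>j\<in>I. a i j * y i * z j)" for y z :: "'i \<Rightarrow> real"
  define N where "N y = (\<Sum>i\<in>I. (y i)\<^sup>2)" for y :: "'i \<Rightarrow> real"
  \<comment> \<open>Fixing the coordinates outside \<open>I\<close> to \<open>0\<close> makes the sphere compact even if the index type
    is infinite.\<close>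
  define S where "S = PiE UNIV (\<lambda>i. if i \<in> I then {-1..1} else {0::real}) \<inter> {y. N y = 1}"
  have cont: "continuous_on UNIV (\<lambda>y :: 'i \<Rightarrow> real. y i)" for i
    by (rule continuous_on_product_coordinates)
  have "compact (PiE UNIV (\<lambda>i. if i \<in> I then {-1..1} else {0::real}))"
    unfolding compactin_euclidean_iff[symmetric] euclidean_product_topology[symmetric]
      compactin_PiE by auto
  moreover have "closed {y. N y = 1}"
    unfolding N_def by (intro closed_Collect_eq continuous_intros cont)
  ultimately have "compact S"
    unfolding S_def by (rule compact_Int_closed)
  moreover have "S \<noteq> {}"
  proof -
    obtain i0 where i0: "i0 \<in> I" using ne by blast
    have "(\<lambda>i. if i = i0 then 1 else 0) \<in> S"
      unfolding S_def N_def using i0 fin by (auto simp: if_distrib[of "\<lambda>x. x\<^sup>2"] cong: if_cong)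
    then show ?thesis by blast
  qed
  moreover have "continuous_on S (\<lambda>y. B y y)"
    unfolding B_def
    by (intro continuous_intros continuous_on_subset[OF cont] subset_UNIV)
  ultimately obtain x where x: "x \<in> S" and max: "\<And>y. y \<in> S \<Longrightarrow> B y y \<le> B x x"
    using continuous_attains_sup[of S "\<lambda>y. B y y"] by blast
  define m where "m = B x x"
  have Nx: "N x = 1" using x by (simp add: S_def)
  have bound: "B y y \<le> m * N y" for y
  proof (cases "N y = 0")
    case True
    then have "y i = 0" if "i \<in> I" for i
      using that fin by (auto simp: N_def sum_nonneg_eq_0_iff)
    then have "B y y = 0" by (simp add: B_def)
    then show ?thesis using True by simp
  next
    case False
    have "N y \<ge> 0" by (simp add: N_def sum_nonneg)
    with False have pos: "N y > 0" by simp
    define z where "z i = (if i \<in> I then y i / sqrt (N y) else 0)" for i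
    have "N z = (\<Sum>i\<in>I. (y i)\<^sup>2 / N y)"
      unfolding N_def[of z] z_def using pos by (intro sum.cong) (auto simp: power_divide)
    also have "\<dots> = N y / N y"
      unfolding N_def by (rule sum_divide_distrib[symmetric])
    finally have Nz: "N z = 1"
      using pos by simp
    have "-1 \<le> z i \<and> z i \<le> 1" if "i \<in> I" for i
    proof -
      have "(z i)\<^sup>2 \<le> N z"
        unfolding N_def using that fin by (intro member_le_sum) auto
      then have "\<bar>z i\<bar> \<le> 1" using Nz abs_square_le_1[of "z i"] by simp
      then show ?thesis by linarith
    qed
    moreover have "z i = 0" if "i \<notin> I" for i
      using that by (simp add: z_def)
    ultimately have "z \<in> S"
      using Nz by (auto simp: S_def)
    then have "B z z \<le> m" unfolding m_def by (rule max)
    moreover have "B z z = (\<Sum>i\<in>I. \<Sum>j\<in>I. a i j * y i * y j / N y)"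
      unfolding B_def z_def using pos
      by (intro sum.cong refl) (simp add: real_sqrt_mult_self)
    then have "B z z = B y y / N y"
      by (simp add: B_def sum_divide_distrib)
    ultimately show ?thesis using pos by (simp add: divide_le_eq)
  qed
  have eig: "(\<Sum>j\<in>I. a i j * x j) = m * x i" if i: "i \<in> I" for i
  proof -
    define e :: "'i \<Rightarrow> real" where "e j = (if j = i then 1 else 0)" for j
    have Bxe: "B x e = (\<Sum>j\<in>I. a i j * x j)"
      unfolding B_def e_def using i fin sym
      by (auto simp: if_distrib[of "\<lambda>x. _ * x"] cong: if_cong intro!: sum.cong)
    have Bsym: "B e x = B x e"
      unfolding B_def by (subst sum.swap) (auto intro!: sum.cong simp: sym)
    have Nt: "N (\<lambda>j. x j + t * e j) = N x + 2 * t * x i + t\<^sup>2 * N e" for t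
    proof -
      have "N (\<lambda>j. x j + t * e j) = (\<Sum>j\<in>I. (x j)\<^sup>2 + 2 * t * (x j * e j) + t\<^sup>2 * (e j)\<^sup>2)"
        unfolding N_def by (intro sum.cong refl) (simp add: power2_eq_square algebra_simps)
      also have "\<dots> = N x + 2 * t * (\<Sum>j\<in>I. x j * e j) + t\<^sup>2 * N e"
        by (simp add: N_def sum.distrib sum_distrib_left)
      also have "(\<Sum>j\<in>I. x j * e j) = x i"
        using i fin by (simp add: e_def if_distrib[of "\<lambda>x. _ * x"] cong: if_cong)
      finally show ?thesis .
    qed
    have Bt: "B (\<lambda>j. x j + t * e j) (\<lambda>j. x j + t * e j) = m + 2 * t * B x e + t\<^sup>2 * B e e" for t
    proof -
      have "B (\<lambda>j. x j + t * e j) (\<lambda>j. x j + t * e j) = B x x + t * B x e + t * B e x + t\<^sup>2 * B e e"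
        unfolding B_def by (simp add: sum.distrib sum_distrib_left power2_eq_square algebra_simps)
      then show ?thesis by (simp add: Bsym m_def)
    qed
    have "m * x i - B x e = 0"
    proof (rule quadratic_min_at_zero)
      fix t
      have "m + 2 * t * B x e + t\<^sup>2 * B e e \<le> m * (1 + 2 * t * x i + t\<^sup>2 * N e)"
        using bound[of "\<lambda>j. x j + t * e j"] unfolding Bt Nt Nx .
      then show "0 \<le> 2 * t * (m * x i - B x e) + t\<^sup>2 * (m * N e - B e e)"
        by (simp add: algebra_simps)
    qed
    then show ?thesis by (simp add: Bxe)
  qed
  have nz: "\<exists>i\<in>I. x i \<noteq> 0"
    using Nx by (auto simp: N_def intro: ccontr)
  show thesis
    by (rule that[OF nz eig]) (use bound in \<open>auto simp: B_def N_def\<close>)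
qed

text \<open>
  Being an eigenvalue, the maximum of the Rayleigh quotient is bounded by the largest element of the
  spectrum. This inequality is all that is used about eigenvalues below.
\<close>

lemma real_symmetric_Rayleigh:
  fixes A :: "real mat"
  assumes A: "A \<in> carrier_mat n n" and n: "n > 0"
    and sym: "\<And>i j. i < n \<Longrightarrow> j < n \<Longrightarrow> A $$ (i, j) = A $$ (j, i)"
  shows "(\<Sum>i<n. \<Sum>j<n. A $$ (i, j) * y i * y j) \<le> Max (spectrum A) * (\<Sum>i<n. (y i)\<^sup>2)"
proof -
  obtain m x where nz: "\<exists>i\<in>{..<n}. x i \<noteq> 0"
    and eig: "\<And>i. i \<in> {..<n} \<Longrightarrow> (\<Sum>j<n. A $$ (i, j) * x j) = m * x i"
    and bd: "\<And>y. (\<Sum>i<n. \<Sum>j<n. A $$ (i, j) * y i * y j) \<le> m * (\<Sum>i<n. (y i)\<^sup>2)"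
    by (rule symmetric_form_max_eigenvalue[of "{..<n}" "\<lambda>i j. A $$ (i, j)"])
       (use n sym in auto)
  have "eigenvector A (Matrix.vec n x) m"
    unfolding eigenvector_def
  proof (intro conjI)
    show "Matrix.vec n x \<noteq> 0\<^sub>v (dim_row A)"
      using nz A by (auto simp: vec_eq_iff)
    show "A *\<^sub>v Matrix.vec n x = m \<cdot>\<^sub>v Matrix.vec n x"
      using A eig by (intro eq_vecI) (auto simp: scalar_prod_def lessThan_atLeast0)
  qed (use A in auto)
  then have "m \<in> spectrum A"
    by (auto simp: spectrum_def eigenvalue_def)
  then have "m \<le> Max (spectrum A)"
    using card_finite_spectrum(1)[OF A] by simp
  moreover have "(\<Sum>i<n. (y i)\<^sup>2) \<ge> 0"
    by (simp add: sum_nonneg)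
  ultimately show ?thesis
    using bd[of y] mult_right_mono order_trans by blast
qed

lemma graph_spectral_radius_Rayleigh:
  assumes fin: "finite (pverts G)" and ne: "pverts G \<noteq> {}"
    and sub: "parcs G \<subseteq> pverts G \<times> pverts G" and sym: "sym (parcs G)"
  shows "(\<Sum>(u, v)\<in>parcs G. y u * y v) \<le> graph_spectral_radius G * (\<Sum>v\<in>pverts G. (y v)\<^sup>2)"
proof -
  define vs where "vs = vertex_enum G"
  have vs: "distinct vs" "set vs = pverts G"
    using someI_ex[OF finite_distinct_list[OF fin]]
    unfolding vs_def vertex_enum_def by (auto simp: conj_commute)
  define n where "n = length vs"
  define A where "A = adjacency_matrix G vs"
  have A: "A \<in> carrier_mat n n" by (simp add: A_def adjacency_matrix_def n_def)
  have Aij: "A $$ (i, j) = (if (vs ! i, vs ! j) \<in> parcs G then 1 else 0)" if "i < n" "j < n" for i j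
    using that by (simp add: A_def adjacency_matrix_def n_def)
  have bij: "bij_betw ((!) vs) {..<n} (pverts G)"
    using bij_betw_nth[OF vs(1)] vs(2) n_def by blast
  have "n > 0" using ne vs n_def by auto
  moreover have "A $$ (i, j) = A $$ (j, i)" if "i < n" "j < n" for i j
    using that sym by (auto simp: Aij dest: symD)
  ultimately have "(\<Sum>i<n. \<Sum>j<n. A $$ (i, j) * y (vs ! i) * y (vs ! j))
      \<le> Max (spectrum A) * (\<Sum>i<n. (y (vs ! i))\<^sup>2)"
    using A by (intro real_symmetric_Rayleigh) auto
  moreover have "(\<Sum>i<n. (y (vs ! i))\<^sup>2) = (\<Sum>v\<in>pverts G. (y v)\<^sup>2)"
    using sum.reindex_bij_betw[OF bij, of "\<lambda>v. (y v)\<^sup>2"] .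
  moreover have "(\<Sum>i<n. \<Sum>j<n. A $$ (i, j) * y (vs ! i) * y (vs ! j))
      = (\<Sum>(u, v)\<in>parcs G. y u * y v)"
  proof -
    define g where "g u v = (if (u, v) \<in> parcs G then y u * y v else 0)" for u v
    have "(\<Sum>i<n. \<Sum>j<n. A $$ (i, j) * y (vs ! i) * y (vs ! j)) = (\<Sum>i<n. \<Sum>j<n. g (vs ! i) (vs ! j))"
      by (intro sum.cong refl) (auto simp: Aij g_def)
    also have "\<dots> = (\<Sum>i<n. \<Sum>v\<in>pverts G. g (vs ! i) v)"
      using sum.reindex_bij_betw[OF bij] by (intro sum.cong refl)
    also have "\<dots> = (\<Sum>u\<in>pverts G. \<Sum>v\<in>pverts G. g u v)"
      using sum.reindex_bij_betw[OF bij] .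
    also have "\<dots> = (\<Sum>(u, v)\<in>pverts G \<times> pverts G. g u v)"
      by (rule sum.cartesian_product)
    also have "\<dots> = (\<Sum>(u, v)\<in>parcs G. g u v)"
      using fin sub by (intro sum.mono_neutral_right) (auto simp: g_def)
    also have "\<dots> = (\<Sum>(u, v)\<in>parcs G. y u * y v)"
      by (intro sum.cong) (auto simp: g_def)
    finally show ?thesis .
  qed
  ultimately show ?thesis
    unfolding graph_spectral_radius_def A_def vs_def by simp
qed

section \<open>The degree-weighted test vector\<close>

text \<open>
  The vector \<open>x\<close> of square roots of the degrees in \<open>D\<close> has squared norm equal to the number of arcs
  of \<open>D\<close>, and each arc of \<open>D\<close> contributes at least \<open>c\<close> to the quadratic form of \<open>C\<close> at \<open>x\<close>. A Rayleigh
  quotient of at most \<open>c\<close> therefore leaves no slack: each arc of \<open>D\<close> contributes exactly \<open>c\<close>, and the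
  other arcs of \<open>C\<close> contribute nothing, so that they touch a vertex isolated in \<open>D\<close>. Neither can such
  an arc have just one end isolated in \<open>D\<close>, since a small positive weight on that end would push the
  Rayleigh quotient above \<open>c\<close>.
\<close>

lemma degree_weighted_test_vector:
  fixes c :: real
  assumes fin: "finite V" and CV: "C \<subseteq> V \<times> V" and symC: "sym C"
    and DC: "D \<subseteq> C" and c0: "c > 0"
    and Rayleigh: "\<And>y. (\<Sum>(u, v)\<in>C. y u * y v) \<le> c * (\<Sum>v\<in>V. (y v)\<^sup>2)"
    and prod: "\<And>u v. (u, v) \<in> D \<Longrightarrow> c\<^sup>2 \<le> real (card (D `` {u})) * real (card (D `` {v}))"
  shows "\<And>u v. (u, v) \<in> D \<Longrightarrow> real (card (D `` {u})) * real (card (D `` {v})) = c\<^sup>2"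
    and "\<And>u v. (u, v) \<in> C - D \<Longrightarrow> D `` {u} = {} \<and> D `` {v} = {}"
proof -
  define d where "d u = real (card (D `` {u}))" for u
  define x where "x u = sqrt (d u)" for u
  have finC: "finite C" using fin CV finite_subset by blast
  have finD: "finite D" using finC DC finite_subset by blast
  have finN: "finite (D `` {u})" for u using finD by (rule finite_Image)
  have d0: "d u \<ge> 0" and x0: "x u \<ge> 0" for u by (auto simp: d_def x_def)
  have degsum: "(\<Sum>v\<in>V. (x v)\<^sup>2) = real (card D)"
  proof -
    have "D = (SIGMA u:V. D `` {u})" using DC CV by auto
    then have "card D = (\<Sum>u\<in>V. card (D `` {u}))"
      using card_SigmaI[OF fin, of "\<lambda>u. D `` {u}"] finN by metis
    then show ?thesis by (simp add: x_def d_def)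
  qed
  have xD: "c \<le> x u * x v" if "(u, v) \<in> D" for u v
    using prod[OF that] c0 unfolding x_def d_def real_sqrt_mult[symmetric] by (intro real_le_rsqrt)
  have split: "(\<Sum>(u, v)\<in>C. x u * x v) = (\<Sum>(u, v)\<in>D. x u * x v) + (\<Sum>(u, v)\<in>C - D. x u * x v)"
    using sum.subset_diff[OF DC finC] by (simp add: add.commute)
  have upper: "(\<Sum>(u, v)\<in>C. x u * x v) \<le> c * real (card D)"
    using Rayleigh[of x] by (simp add: degsum)
  have lower: "c * real (card D) \<le> (\<Sum>(u, v)\<in>D. x u * x v)"
  proof -
    have "c * real (card D) = (\<Sum>p\<in>D. c)" by simp
    also have "\<dots> \<le> (\<Sum>(u, v)\<in>D. x u * x v)" by (intro sum_mono) (auto dest: xD)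
    finally show ?thesis .
  qed
  have rest0: "(\<Sum>(u, v)\<in>C - D. x u * x v) \<ge> 0"
    by (intro sum_nonneg) (auto simp: x0)
  have eqC: "(\<Sum>(u, v)\<in>C. x u * x v) = c * real (card D)"
    using upper lower rest0 split by linarith
  have "(\<Sum>(u, v)\<in>D. x u * x v) = c * real (card D)"
    using upper lower rest0 split by linarith
  then have eqD: "(\<Sum>(u, v)\<in>D. x u * x v - c) = 0"
    by (simp add: sum_subtractf case_prod_unfold)
  show "real (card (D `` {u})) * real (card (D `` {v})) = c\<^sup>2" if uv: "(u, v) \<in> D" for u v
  proof -
    have "\<forall>p\<in>D. (\<lambda>(u, v). x u * x v - c) p = 0"
      using eqD by (subst (asm) sum_nonneg_eq_0_iff[OF finD]) (auto dest: xD)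
    then have "x u * x v = c" using uv by force
    then have "(x u * x v)\<^sup>2 = c\<^sup>2" by simp
    then show ?thesis by (simp add: x_def d_def power_mult_distrib)
  qed
  have extra: "\<forall>p\<in>C - D. (\<lambda>(u, v). x u * x v) p = 0"
  proof -
    have "(\<Sum>(u, v)\<in>C - D. x u * x v) = 0"
      using upper lower rest0 split by linarith
    then show ?thesis
      by (subst (asm) sum_nonneg_eq_0_iff) (auto simp: finC x0)
  qed
  have no_half: "x u = 0" if uv: "(u, v) \<in> C" and v: "x v = 0" for u v
  proof (rule ccontr)
    assume "x u \<noteq> 0"
    with x0[of u] have xu: "x u > 0" by linarith
    have vV: "v \<in> V" and uV: "u \<in> V" using uv CV by auto
    have neq: "u \<noteq> v" using xu v by auto
    have vu: "(v, u) \<in> C" using uv symC by (meson symD)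
    \<comment> \<open>Weight \<open>t\<close> on \<open>v\<close> gains \<open>2 * t * x u\<close> in the form and costs \<open>c * t\<^sup>2\<close>; the choice maximises the
      difference.\<close>
    define t where "t = x u / c"
    have t0: "t > 0" using xu c0 by (simp add: t_def)
    define y where "y = x(v := t)"
    have y: "x w \<le> y w" "0 \<le> y w" for w
      using v t0 x0[of w] by (auto simp: y_def)
    have "(\<Sum>w\<in>V. (y w)\<^sup>2) = (\<Sum>w\<in>V. (x w)\<^sup>2 + (if w = v then t\<^sup>2 else 0))"
      using v by (intro sum.cong) (auto simp: y_def)
    also have "\<dots> = real (card D) + t\<^sup>2"
      using fin vV by (simp add: sum.distrib degsum)
    finally have norm: "(\<Sum>w\<in>V. (y w)\<^sup>2) = real (card D) + t\<^sup>2" .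
    have "(\<Sum>(p, q)\<in>C. x p * x q) + 2 * (t * x u)
        = (\<Sum>e\<in>C. (\<lambda>(p, q). x p * x q) e + (if e = (u, v) then t * x u else 0)
            + (if e = (v, u) then t * x u else 0))"
      using finC uv vu by (simp add: sum.distrib)
    also have "\<dots> \<le> (\<Sum>(p, q)\<in>C. y p * y q)"
    proof (rule sum_mono)
      fix e assume "e \<in> C"
      obtain p q where e: "e = (p, q)" by (cases e)
      have "x p * x q \<le> y p * y q" by (intro mult_mono y x0)
      then show "(\<lambda>(p, q). x p * x q) e + (if e = (u, v) then t * x u else 0)
            + (if e = (v, u) then t * x u else 0) \<le> (\<lambda>(p, q). y p * y q) e"
        unfolding e using neq v by (auto simp: y_def)
    qed
    also have "\<dots> \<le> c * (real (card D) + t\<^sup>2)"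
      using Rayleigh[of y] norm by simp
    finally have "2 * (t * x u) \<le> c * t\<^sup>2"
      unfolding eqC by (simp add: algebra_simps)
    also have "c * t\<^sup>2 = t * x u"
      using c0 by (simp add: t_def power2_eq_square)
    finally show False using t0 xu by (simp add: mult_le_0_iff)
  qed
  have x_iff: "x w = 0 \<longleftrightarrow> D `` {w} = {}" for w
    using finN[of w] by (simp add: x_def d_def)
  show "D `` {u} = {} \<and> D `` {v} = {}" if uv: "(u, v) \<in> C - D" for u v
  proof -
    have "(v, u) \<in> C" using uv symC by (auto dest: symD)
    moreover have "x u = 0 \<or> x v = 0" using extra uv by force
    ultimately have "x u = 0 \<and> x v = 0" using no_half uv by blast
    then show ?thesis by (simp add: x_iff)
  qed
qed

section \<open>Hamiltonian paths and degree sums\<close>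

text \<open>
  Hamiltonian paths as vertex lists, for which reversing and splicing are available; arc walks
  return only at the interface with graphs.
\<close>

definition has_ham_path :: "'a set \<Rightarrow> 'a rel \<Rightarrow> 'a \<Rightarrow> 'a \<Rightarrow> bool" where
  "has_ham_path V E a b \<longleftrightarrow> (\<exists>ws. ws \<noteq> [] \<and> distinct ws \<and> set ws = V \<and> hd ws = a \<and> last ws = b \<and>
     successively (\<lambda>x y. (x, y) \<in> E) ws)"

text \<open>
  Cutting the list at the missing edge between \<open>last ps\<close> and \<open>hd qs\<close> and at a second place \<open>j\<close>, the
  middle piece can be reversed: the two cross edges reconnect the three pieces, and the ends of the
  path do not move.
\<close>

lemma ham_path_rotation:
  assumes ws: "ws = ps @ qs" "ps \<noteq> []" "qs \<noteq> []"
    and dist: "distinct ws" and set: "set ws = V"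
    and sp: "successively (\<lambda>x y. (x, y) \<in> E) ps" and sq: "successively (\<lambda>x y. (x, y) \<in> E) qs"
    and sym: "sym E"
    and j: "Suc j < length ws" and j_neq: "Suc j \<noteq> length ps"
    and e1: "(last ps, ws ! j) \<in> E" and e2: "(hd qs, ws ! Suc j) \<in> E"
  shows "has_ham_path V E (hd ws) (last ws)"
proof -
  have rev_path: "successively (\<lambda>x y. (x, y) \<in> E) (rev zs)"
    if "successively (\<lambda>x y. (x, y) \<in> E) zs" for zs
    unfolding successively_rev
    by (rule successively_mono[OF that]) (use sym in \<open>auto dest: symD\<close>)
  have sub: "successively (\<lambda>x y. (x, y) \<in> E) (take m zs)"
    "successively (\<lambda>x y. (x, y) \<in> E) (drop m zs)"
    if "successively (\<lambda>x y. (x, y) \<in> E) zs" for zs m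
    using that append_take_drop_id[of m zs] successively_append_iff by metis+
  consider "Suc j < length ps" | "length ps < Suc j" using j_neq by linarith
  then show ?thesis
  proof cases
    case 1
    define p1 p2 where "p1 = take (Suc j) ps" and "p2 = drop (Suc j) ps"
    have p: "ps = p1 @ p2" "p1 \<noteq> []" "p2 \<noteq> []" using 1 ws by (auto simp: p1_def p2_def)
    have "last p1 = ws ! j" "hd p2 = ws ! Suc j"
      using 1 by (simp_all add: p1_def p2_def take_Suc_conv_app_nth hd_drop_conv_nth ws nth_append)
    then have j: "(last p1, last p2) \<in> E" "(hd p2, hd qs) \<in> E"
      using e1 e2 symD[OF sym] p by simp_all
    have "successively (\<lambda>x y. (x, y) \<in> E) p1" "successively (\<lambda>x y. (x, y) \<in> E) (rev p2)"
      unfolding p1_def p2_def by (rule sub[OF sp], rule rev_path[OF sub(2)[OF sp]])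
    then have "successively (\<lambda>x y. (x, y) \<in> E) (p1 @ rev p2 @ qs)"
      using j p(2,3) sq ws(3)
      by (simp add: successively_append_iff hd_rev last_rev hd_append del: successively_rev)
    then show ?thesis
      unfolding has_ham_path_def using dist set p ws
      by (intro exI[of _ "p1 @ rev p2 @ qs"]) auto
  next
    case 2
    define m where "m = Suc j - length ps"
    define q1 q2 where "q1 = take m qs" and "q2 = drop m qs"
    have m: "0 < m" "m < length qs" using 2 j ws by (auto simp: m_def)
    have q: "qs = q1 @ q2" "q1 \<noteq> []" "q2 \<noteq> []" using m by (auto simp: q1_def q2_def)
    obtain l where l: "m = Suc l" using m(1) by (cases m) auto
    have Sj: "Suc j = length ps + m" "j = length ps + l"
      using 2 l by (auto simp: m_def)
    have "hd q2 = ws ! Suc j"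
      unfolding Sj(1) using m by (simp add: q2_def hd_drop_conv_nth ws nth_append)
    moreover have "last q1 = ws ! j"
      using m(2) by (simp add: Sj(2) l q1_def take_Suc_conv_app_nth ws nth_append)
    moreover note e1 e2
    ultimately have j: "(last ps, last q1) \<in> E" "(hd q1, hd q2) \<in> E"
      using q by simp_all
    have "successively (\<lambda>x y. (x, y) \<in> E) (rev q1)" "successively (\<lambda>x y. (x, y) \<in> E) q2"
      unfolding q1_def q2_def by (rule rev_path[OF sub(1)[OF sq]], rule sub[OF sq])
    then have "successively (\<lambda>x y. (x, y) \<in> E) (ps @ rev q1 @ q2)"
      using j q(2,3) sp ws(2)
      by (simp add: successively_append_iff hd_rev last_rev hd_append del: successively_rev)
    then show ?thesis
      unfolding has_ham_path_def using dist set q ws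
      by (intro exI[of _ "ps @ rev q1 @ q2"]) auto
  qed
qed

text \<open>
  Ore's counting argument. By the rotation, \<open>j\<close> cannot at once index a neighbour of \<open>u\<close> and precede the
  index of a neighbour of \<open>v\<close>. The two index sets are thus disjoint subsets of the \<open>n - 1\<close> positions
  with a successor, and both omit the position of \<open>u\<close> itself. They account for all neighbours
  except possibly \<open>b\<close> (which has no successor) for \<open>u\<close>, and \<open>a\<close> (which has no predecessor) for \<open>v\<close>.
\<close>

lemma ore_degree_count:
  assumes EV: "E \<subseteq> V \<times> V" and sym: "sym E" and irr: "irrefl E"
    and no: "\<not> has_ham_path V E a b" and nE: "(u, v) \<notin> E"
    and ws: "ws = ps @ qs" "ps \<noteq> []" "qs \<noteq> []" "distinct ws" "set ws = V"
    and uv: "last ps = u" "hd qs = v"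
    and ab: "hd ws = a" "last ws = b"
    and sp: "successively (\<lambda>x y. (x, y) \<in> E) ps" and sq: "successively (\<lambda>x y. (x, y) \<in> E) qs"
  shows "card (E `` {u} - {b}) + card (E `` {v} - {a}) + 2 \<le> card V"
proof -
  define n where "n = length ws"
  have n: "card V = n" using ws distinct_card n_def by metis
  have n2: "n \<ge> 2" using ws by (cases ps; cases qs) (auto simp: n_def)
  define S where "S = {j. Suc j < n \<and> (u, ws ! j) \<in> E}"
  define T where "T = {j. Suc j < n \<and> (v, ws ! Suc j) \<in> E}"
  define i where "i = length ps - 1"
  have "length ps > 0" "length qs > 0" "n = length ps + length qs" using ws by (auto simp: n_def)
  then have i: "Suc i = length ps" "i < n - 1" unfolding i_def by linarith+
  have wi: "ws ! i = u" "ws ! Suc i = v"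
    using ws uv i by (auto simp: nth_append last_conv_nth hd_conv_nth i_def)
  have disj: "S \<inter> T = {}"
  proof (rule ccontr)
    assume "S \<inter> T \<noteq> {}"
    then obtain j where j: "Suc j < n" "(u, ws ! j) \<in> E" "(v, ws ! Suc j) \<in> E"
      by (auto simp: S_def T_def)
    moreover have "Suc j \<noteq> length ps"
      using j wi irr i by (auto simp: irrefl_def)
    ultimately show False
      using ham_path_rotation[OF ws sp sq sym, of j] no uv ab by (auto simp: n_def)
  qed
  have iS: "i \<notin> S" "i \<notin> T" using wi irr by (auto simp: S_def T_def irrefl_def)
  have "S \<subseteq> {..<n}" "T \<subseteq> {..<n}" by (auto simp: S_def T_def)
  then have finST: "finite S" "finite T" using finite_subset by blast+
  have "ws \<noteq> []" using ws(1,2) by simp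
  then have a: "a = ws ! 0" and b: "b = ws ! (n - 1)"
    unfolding ab[symmetric] n_def by (rule hd_conv_nth, rule last_conv_nth)
  have in_ws: "\<exists>j<n. w = ws ! j" if "(x, w) \<in> E" for x w
    using that EV ws(5) unfolding n_def by (metis (no_types) SigmaD2 in_set_conv_nth subsetD)
  have "E `` {u} - {b} \<subseteq> (!) ws ` S"
  proof
    fix w assume w: "w \<in> E `` {u} - {b}"
    then obtain j where j: "j < n" "w = ws ! j" using in_ws by blast
    have "Suc j \<noteq> n" using w j b by auto
    then show "w \<in> (!) ws ` S" using j w by (auto simp: S_def)
  qed
  then have cS: "card (E `` {u} - {b}) \<le> card S"
    using finST by (meson card_image_le card_mono finite_imageI order_trans)
  have "E `` {v} - {a} \<subseteq> (\<lambda>j. ws ! Suc j) ` T"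
  proof
    fix w assume w: "w \<in> E `` {v} - {a}"
    then obtain j where j: "j < n" "w = ws ! j" using in_ws by blast
    have "j \<noteq> 0" using w j a by (metis DiffD2 insertI1)
    then obtain j' where "j = Suc j'" by (cases j) auto
    then show "w \<in> (\<lambda>j. ws ! Suc j) ` T" using j w by (auto simp: T_def)
  qed
  then have cT: "card (E `` {v} - {a}) \<le> card T"
    using finST by (meson card_image_le card_mono finite_imageI order_trans)
  have "card S + card T = card (S \<union> T)" using disj finST by (simp add: card_Un_disjoint)
  also have "\<dots> \<le> card ({..<n - 1} - {i})"
    using iS by (intro card_mono) (auto simp: S_def T_def)
  also have "\<dots> = n - 2" using i by (simp add: card_Diff_singleton)
  finally show ?thesis using cS cT n n2 by linarith
qed

lemma successively_avoiding_edge: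
  assumes "successively (\<lambda>x y. (x, y) \<in> insert (u, v) (insert (v, u) E)) zs"
    and "u \<notin> set zs \<or> v \<notin> set zs"
  shows "successively (\<lambda>x y. (x, y) \<in> E) zs"
  by (rule successively_mono[OF assms(1)]) (use assms(2) in auto)

text \<open>
  If adding the edge \<open>uv\<close> creates a Hamiltonian path from \<open>a\<close> to \<open>b\<close>, the new path crosses \<open>uv\<close>. The
  strict form comes from the end vertices: an end of the path that lies on the new edge is not a
  neighbour of the other end of that edge, so that one of the two exceptional neighbours in the
  count does not exist.
\<close>

lemma ore_nonadjacent_degree_sum:
  assumes fin: "finite V" and EV: "E \<subseteq> V \<times> V" and sym: "sym E" and irr: "irrefl E"
    and no: "\<not> has_ham_path V E a b"
    and yes: "has_ham_path V (insert (u, v) (insert (v, u) E)) a b"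
    and nE: "(u, v) \<notin> E" 
  shows "card (E `` {u}) + card (E `` {v}) \<le> card V"
    and "u \<in> {a, b} \<Longrightarrow> card (E `` {u}) + card (E `` {v}) < card V"
proof -
  have nE': "(v, u) \<notin> E" using nE sym by (auto dest: symD)
  have finN: "finite (E `` {w})" for w
    using fin EV finite_subset[of E "V \<times> V"] by auto
  obtain ws where ws: "ws \<noteq> []" "distinct ws" "set ws = V" and ab: "hd ws = a" "last ws = b"
    and path: "successively (\<lambda>x y. (x, y) \<in> insert (u, v) (insert (v, u) E)) ws"
    using yes unfolding has_ham_path_def by blast
  have "\<not> successively (\<lambda>x y. (x, y) \<in> E) ws"
    using no ws ab unfolding has_ham_path_def by blast
  then obtain i where i: "Suc i < length ws" "(ws ! i, ws ! Suc i) \<notin> E"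
    unfolding successively_conv_nth by blast
  have "(ws ! i, ws ! Suc i) \<in> insert (u, v) (insert (v, u) E)"
    using path i(1) unfolding successively_conv_nth by blast
  with i(2) have uv: "ws ! i = u \<and> ws ! Suc i = v \<or> ws ! i = v \<and> ws ! Suc i = u" by auto
  define ps qs where "ps = take (Suc i) ws" and "qs = drop (Suc i) ws"
  have pq: "ws = ps @ qs" "ps \<noteq> []" "qs \<noteq> []" using i(1) by (auto simp: ps_def qs_def)
  have ends: "last ps = ws ! i" "hd qs = ws ! Suc i"
    using i(1) by (simp_all add: ps_def qs_def take_Suc_conv_app_nth hd_drop_conv_nth)
  have "last ps \<in> set ps" "hd qs \<in> set qs" using pq by auto
  then have "ws ! i \<notin> set qs" "ws ! Suc i \<notin> set ps"
    using ws(2) unfolding ends pq(1) by (auto simp: pq(1))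
  then have av: "u \<notin> set ps \<or> v \<notin> set ps" "u \<notin> set qs \<or> v \<notin> set qs"
    using uv by auto
  have "successively (\<lambda>x y. (x, y) \<in> insert (u, v) (insert (v, u) E)) ps"
    "successively (\<lambda>x y. (x, y) \<in> insert (u, v) (insert (v, u) E)) qs"
    using path pq(1) successively_append_iff by metis+
  then have sp: "successively (\<lambda>x y. (x, y) \<in> E) ps" "successively (\<lambda>x y. (x, y) \<in> E) qs"
    using successively_avoiding_edge av by metis+
  have count: "card (E `` {ws ! i} - {b}) + card (E `` {ws ! Suc i} - {a}) + 2 \<le> card V"
    using i(2) by (intro ore_degree_count[OF EV sym irr no _ pq ws(2,3) ends ab sp])
  have le1: "card (E `` {w}) \<le> card (E `` {w} - {z}) + 1" for w z
  proof (cases "z \<in> E `` {w}")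
    case True
    then show ?thesis using card_Suc_Diff1[OF finN[of w]] by fastforce
  qed simp
  have sum: "card (E `` {ws ! i}) + card (E `` {ws ! Suc i}) \<le> card V"
    using count le1[of "ws ! i" b] le1[of "ws ! Suc i" a] by linarith
  then show "card (E `` {u}) + card (E `` {v}) \<le> card V"
    using uv by (auto simp: add.commute)
  have strict: "card (E `` {ws ! i}) + card (E `` {ws ! Suc i}) < card V" if "u \<in> {a, b}"
  proof -
    have aN: "ws ! Suc i \<noteq> a" "ws ! i \<noteq> b"
      using i(1) ws(1,2) ab
      by (auto simp: hd_conv_nth last_conv_nth nth_eq_iff_index_eq)
    then have "ws ! i = a \<or> ws ! Suc i = b" using uv that by auto
    then have "a \<notin> E `` {ws ! Suc i} \<or> b \<notin> E `` {ws ! i}"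
      using i(2) sym by (auto dest: symD)
    then have "E `` {ws ! Suc i} - {a} = E `` {ws ! Suc i} \<or> E `` {ws ! i} - {b} = E `` {ws ! i}"
      by auto
    then show ?thesis
    proof
      assume "E `` {ws ! Suc i} - {a} = E `` {ws ! Suc i}"
      then have "card (E `` {ws ! Suc i} - {a}) = card (E `` {ws ! Suc i})" by simp
      then show ?thesis using count le1[of "ws ! i" b] by linarith
    next
      assume "E `` {ws ! i} - {b} = E `` {ws ! i}"
      then have "card (E `` {ws ! i} - {b}) = card (E `` {ws ! i})" by simp
      then show ?thesis using count le1[of "ws ! Suc i" a] by linarith
    qed
  qed
  show "card (E `` {u}) + card (E `` {v}) < card V" if "u \<in> {a, b}"
    using strict[OF that] uv by (auto simp: add.commute)
qed

lemma hamiltonian_path_of_has_ham_path: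
  assumes "has_ham_path (pverts G) (parcs G) a b"
  shows "\<exists>p. hamiltonian_path G a p b"
proof -
  obtain ws where ws: "ws \<noteq> []" "distinct ws" "set ws = pverts G" "hd ws = a" "last ws = b"
    "successively (\<lambda>x y. (x, y) \<in> parcs G) ws"
    using assms unfolding has_ham_path_def by blast
  have walk: "pawalk_verts (hd ws) (zip ws (tl ws)) = ws \<and> pcas (hd ws) (zip ws (tl ws)) (last ws)
      \<and> set (zip ws (tl ws)) \<subseteq> parcs G"
    if "ws \<noteq> []" "successively (\<lambda>x y. (x, y) \<in> parcs G) ws" for ws
    using that
  proof (induction ws rule: induct_list012)
    case (3 x y zs)
    then show ?case by simp
  qed auto
  have "a \<in> pverts G" using hd_in_set[OF ws(1)] unfolding ws(3,4) .
  with walk[OF ws(1,6)] have "hamiltonian_path G a (zip ws (tl ws)) b"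
    unfolding hamiltonian_path_def pre_digraph.apath_def pre_digraph.awalk_def
      cas_with_proj_eq awalk_verts_with_proj_eq ws(4,5)
    using ws(2,3) by simp
  then show ?thesis ..
qed

definition complete_arcs :: "'a set \<Rightarrow> 'a rel" where
  "complete_arcs V = {(u, v). u \<in> V \<and> v \<in> V \<and> u \<noteq> v}"

lemma mem_complete_arcs [simp]: "(u, v) \<in> complete_arcs V \<longleftrightarrow> u \<in> V \<and> v \<in> V \<and> u \<noteq> v"
  by (simp add: complete_arcs_def)

lemma has_ham_path_complete:
  assumes fin: "finite V" and ab: "a \<in> V" "b \<in> V" "a \<noteq> b"
  shows "has_ham_path V (complete_arcs V) a b"
proof -
  obtain zs where zs: "distinct zs" "set zs = V - {a, b}"
    using finite_distinct_list[of "V - {a, b}"] fin by auto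
  define ws where "ws = a # zs @ [b]"
  have ws: "distinct ws" "set ws = V" using zs ab by (auto simp: ws_def)
  have "successively (\<lambda>x y. (x, y) \<in> complete_arcs V) ws"
    unfolding successively_conv_nth
  proof (intro allI impI)
    fix i assume i: "Suc i < length ws"
    then have "ws ! i \<in> V" "ws ! Suc i \<in> V"
      unfolding ws(2)[symmetric] by (metis Suc_lessD nth_mem)+
    moreover have "ws ! i \<noteq> ws ! Suc i"
      using i ws(1) by (simp add: nth_eq_iff_index_eq)
    ultimately show "(ws ! i, ws ! Suc i) \<in> complete_arcs V" by simp
  qed
  then show ?thesis
    unfolding has_ham_path_def using ws by (intro exI[of _ ws]) (auto simp: ws_def)
qed

text \<open>
  An edge-maximal supergraph takes the place of the Bondy-Chvatal closure: the pair \<open>a\<close>, \<open>b\<close> is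
  kept, so that every missing edge can be compared with one and the same pair of ends.
\<close>

lemma maximal_without_ham_path:
  assumes fin: "finite V" and A: "A \<subseteq> complete_arcs V" "sym A" "\<not> has_ham_path V A a b"
  obtains E where "A \<subseteq> E" "E \<subseteq> complete_arcs V" "sym E" "\<not> has_ham_path V E a b"
    and "\<And>u v. (u, v) \<in> complete_arcs V - E \<Longrightarrow> has_ham_path V (insert (u, v) (insert (v, u) E)) a b"
proof -
  define F where "F = {E. E \<subseteq> complete_arcs V \<and> sym E \<and> \<not> has_ham_path V E a b}"
  have "complete_arcs V \<subseteq> V \<times> V" by auto
  then have "finite (complete_arcs V)"
    using fin by (meson finite_SigmaI finite_subset)
  then have "finite F"
    by (rule finite_subset[rotated, OF iffD2[OF finite_Pow_iff]]) (auto simp: F_def)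
  moreover have "A \<in> F" using A by (simp add: F_def)
  ultimately have "\<exists>E\<in>F. A \<subseteq> E \<and> (\<forall>E'\<in>F. E \<subseteq> E' \<longrightarrow> E = E')"
    by (rule finite_has_maximal2)
  then obtain E where E: "E \<in> F" "A \<subseteq> E" and max: "\<And>E'. E' \<in> F \<Longrightarrow> E \<subseteq> E' \<Longrightarrow> E = E'"
    by blast
  show thesis
  proof (rule that)
    fix u v assume uv: "(u, v) \<in> complete_arcs V - E"
    let ?E = "insert (u, v) (insert (v, u) E)"
    show "has_ham_path V ?E a b"
    proof (rule ccontr)
      assume "\<not> has_ham_path V ?E a b"
      moreover have "sym ?E" using E(1) unfolding F_def sym_def by blast
      moreover have "?E \<subseteq> complete_arcs V" using E(1) uv by (auto simp: F_def)
      ultimately have "?E \<in> F" by (simp add: F_def)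
      then show False using max[of ?E] uv by blast
    qed
  qed (use E in \<open>auto simp: F_def\<close>)
qed

lemma card_complete_arcs_diff:
  assumes "finite V" "E \<subseteq> complete_arcs V" "v \<in> V"
  shows "card (E `` {v}) + card ((complete_arcs V - E) `` {v}) + 1 = card V"
proof -
  have "V = insert v (E `` {v} \<union> (complete_arcs V - E) `` {v})"
    using assms(2,3) by auto
  moreover have "E `` {v} \<subseteq> V" using assms(2) by auto
  then have fin: "finite (E `` {v})" "finite ((complete_arcs V - E) `` {v})"
    by (auto intro!: finite_subset[OF _ assms(1)])
  moreover have "v \<notin> E `` {v} \<union> (complete_arcs V - E) `` {v}" using assms(2) by auto
  moreover note fin
  moreover have "E `` {v} \<inter> (complete_arcs V - E) `` {v} = {}" by auto
  ultimately show ?thesis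
    by (metis (no_types, lifting) Suc_eq_plus1 card_Un_disjoint card_insert_disjoint finite_UnI)
qed

text \<open>
  The degree conditions on the maximal supergraph, read in its complement \<open>D\<close>. Note the strict
  inequality at the ends \<open>a\<close> and \<open>b\<close>: whenever the degree sums in \<open>D\<close> are as small as possible, \<open>a\<close> and
  \<open>b\<close> are isolated in \<open>D\<close>.
\<close>

lemma complement_of_maximal_without_ham_path:
  assumes fin: "finite V" and A: "A \<subseteq> complete_arcs V" "sym A" "\<not> has_ham_path V A a b"
    and deg: "\<And>v. v \<in> V \<Longrightarrow> k \<le> card (A `` {v})"
    and ab: "a \<in> V" "b \<in> V" "a \<noteq> b"
  obtains D where "D \<subseteq> complete_arcs V - A" "sym D" "D \<noteq> {}"
    and "\<And>u v. (u, v) \<in> D \<Longrightarrow> card V \<le> card (D `` {u}) + card (D `` {v}) + 2"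
    and "\<And>v. (a, v) \<in> D \<Longrightarrow> card V < card (D `` {a}) + card (D `` {v}) + 2"
    and "\<And>v. (b, v) \<in> D \<Longrightarrow> card V < card (D `` {b}) + card (D `` {v}) + 2"
    and "\<And>u. u \<in> V \<Longrightarrow> card (D `` {u}) + k + 1 \<le> card V"
proof -
  obtain E where E: "A \<subseteq> E" "E \<subseteq> complete_arcs V" "sym E" "\<not> has_ham_path V E a b"
    and max: "\<And>u v. (u, v) \<in> complete_arcs V - E \<Longrightarrow> has_ham_path V (insert (u, v) (insert (v, u) E)) a b"
    by (rule maximal_without_ham_path[OF fin A]) blast
  define D where "D = complete_arcs V - E"
  have EV: "E \<subseteq> V \<times> V" and irr: "irrefl E" using E(2) by (auto simp: irrefl_def)
  have finE: "finite (E `` {v})" for v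
    using EV fin by (auto intro: finite_subset[OF _ fin])
  have compl: "card (E `` {v}) + card (D `` {v}) + 1 = card V" if "v \<in> V" for v
    unfolding D_def by (rule card_complete_arcs_diff[OF fin E(2) that])
  have DV: "u \<in> V" "v \<in> V" if "(u, v) \<in> D" for u v using that by (auto simp: D_def)
  have sums: "card V \<le> card (D `` {u}) + card (D `` {v}) + 2"
    "u \<in> {a, b} \<Longrightarrow> card V < card (D `` {u}) + card (D `` {v}) + 2" if uv: "(u, v) \<in> D" for u v
  proof -
    have "has_ham_path V (insert (u, v) (insert (v, u) E)) a b" "(u, v) \<notin> E"
      using max uv by (auto simp: D_def)
    note ore = ore_nonadjacent_degree_sum[OF fin EV E(3) irr E(4) this]
    show "card V \<le> card (D `` {u}) + card (D `` {v}) + 2"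
      using ore(1) compl[OF DV(1)[OF uv]] compl[OF DV(2)[OF uv]] by linarith
    show "card V < card (D `` {u}) + card (D `` {v}) + 2" if "u \<in> {a, b}"
      using ore(2)[OF that] compl[OF DV(1)[OF uv]] compl[OF DV(2)[OF uv]] by linarith
  qed
  show thesis
  proof (rule that)
    show "D \<subseteq> complete_arcs V - A" using E(1) by (auto simp: D_def)
    show "sym D" using E(3) by (auto simp: D_def sym_def)
    show "D \<noteq> {}"
    proof
      assume "D = {}"
      then have "E = complete_arcs V" using E(2) by (auto simp: D_def)
      then show False using E(4) has_ham_path_complete[OF fin ab] by simp
    qed
  next
    fix u assume u: "u \<in> V"
    have "card (A `` {u}) \<le> card (E `` {u})"
      using E(1) finE by (intro card_mono) auto
    then show "card (D `` {u}) + k + 1 \<le> card V"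
      using deg[OF u] compl[OF u] by linarith
  qed (rule sums; simp)+
qed

text \<open>
  A product is concave along a line of constant sum, hence smallest at an end of the admissible
  segment; the identity in the proof makes this quantitative.
\<close>

lemma product_of_bounded_pair:
  fixes p q m M :: nat
  assumes "p \<le> M" "q \<le> M" "m + M \<le> p + q"
  shows "m * M \<le> p * q"
    and "p * q = m * M \<Longrightarrow> 0 < M \<Longrightarrow> p = M \<and> q = m \<or> p = m \<and> q = M"
proof -
  have id: "int p * int q - int m * int M
      = (int M - int p) * (int M - int q) + int M * (int p + int q - int m - int M)"
    by (simp add: algebra_simps)
  have nn: "0 \<le> (int M - int p) * (int M - int q)" "0 \<le> int M * (int p + int q - int m - int M)"
    using assms by auto
  have "int m * int M \<le> int p * int q" using id nn by linarith
  then show "m * M \<le> p * q" by (simp flip: of_nat_mult)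
  show "p = M \<and> q = m \<or> p = m \<and> q = M" if eq: "p * q = m * M" and M: "0 < M"
  proof -
    have "int p * int q = int m * int M" using eq by (simp flip: of_nat_mult)
    then have "(int M - int p) * (int M - int q) = 0" "int M * (int p + int q - int m - int M) = 0"
      using id nn by linarith+
    then show ?thesis using M by auto
  qed
qed

text \<open>
  Every edge joins a vertex of degree \<open>m\<close> to one of degree \<open>M\<close>, which are different numbers. So a vertex of
  degree \<open>M\<close> has all its neighbours in \<open>Y\<close> and one of degree \<open>m\<close> has them in \<open>X\<close>. Since \<open>a\<close> and \<open>b\<close> take
  two vertices away, there is just enough room for one neighbourhood of each kind, and every
  neighbourhood fills its side.
\<close>

lemma two_degree_complete_bipartite:
  assumes fin: "finite V" and DV: "D \<subseteq> V \<times> V" and ne: "D \<noteq> {}"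
    and ab: "a \<in> V" "b \<in> V" "a \<noteq> b" "D `` {a} = {}" "D `` {b} = {}"
    and card: "card V = m + M + 2" and mM: "0 < m" "m < M"
    and edge: "\<And>u v. (u, v) \<in> D \<Longrightarrow> card (D `` {u}) = M \<and> card (D `` {v}) = m
       \<or> card (D `` {u}) = m \<and> card (D `` {v}) = M"
  obtains X Y where "V = (X \<union> Y) \<union> {a, b}" "X \<inter> Y = {}" "a \<notin> X \<union> Y" "b \<notin> X \<union> Y"
    and "card X = m" "card Y = M" "D = X \<times> Y \<union> Y \<times> X"
proof -
  define X where "X = {v \<in> V. card (D `` {v}) = M}"
  define Y where "Y = {v \<in> V. card (D `` {v}) = m}"
  have finXY: "finite X" "finite Y" using fin by (auto simp: X_def Y_def)
  have disj: "X \<inter> Y = {}" "a \<notin> X \<union> Y" "b \<notin> X \<union> Y"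
    using mM ab by (auto simp: X_def Y_def)
  obtain u v where uv: "(u, v) \<in> D" using ne by auto
  have NX: "D `` {x} \<subseteq> Y" if "x \<in> X" for x
    using that edge mM DV by (force simp: X_def Y_def)
  have NY: "D `` {y} \<subseteq> X" if "y \<in> Y" for y
    using that edge mM DV by (force simp: X_def Y_def)
  obtain x y where x: "x \<in> X" and y: "y \<in> Y"
    using edge[OF uv] uv DV by (auto simp: X_def Y_def)
  have "M \<le> card Y" using card_mono[OF finXY(2) NX[OF x]] x by (simp add: X_def)
  moreover have "m \<le> card X" using card_mono[OF finXY(1) NY[OF y]] y by (simp add: Y_def)
  moreover have cXY: "card (X \<union> Y) = card X + card Y"
    using finXY disj by (simp add: card_Un_disjoint)
  have sub: "(X \<union> Y) \<union> {a, b} \<subseteq> V" using ab by (auto simp: X_def Y_def)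
  have cXYab: "card ((X \<union> Y) \<union> {a, b}) = card X + card Y + 2"
    using finXY disj ab(3) cXY by (subst card_Un_disjoint) auto
  have "card X + card Y \<le> m + M"
    using card_mono[OF fin sub] cXYab card by linarith
  ultimately have cards: "card X = m" "card Y = M" by linarith+
  then have V: "V = (X \<union> Y) \<union> {a, b}"
    using card_subset_eq[OF fin sub] cXYab card by simp
  have NX': "D `` {x} = Y" if "x \<in> X" for x
    by (rule card_subset_eq[OF finXY(2) NX[OF that]]) (use that cards in \<open>simp add: X_def\<close>)
  have NY': "D `` {y} = X" if "y \<in> Y" for y
    by (rule card_subset_eq[OF finXY(1) NY[OF that]]) (use that cards in \<open>simp add: Y_def\<close>)
  have "D \<subseteq> X \<times> Y \<union> Y \<times> X"
  proof
    fix e assume e: "e \<in> D"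
    obtain p q where pq: "e = (p, q)" by (cases e)
    then have "p \<in> V" "q \<in> V" using e DV by auto
    then show "e \<in> X \<times> Y \<union> Y \<times> X" using edge[of p q] e pq by (auto simp: X_def Y_def)
  qed
  moreover have "X \<times> Y \<union> Y \<times> X \<subseteq> D" using NX' NY' by auto
  ultimately show thesis using that[OF V disj cards] by blast
qed

section \<open>Recognising joins up to isomorphism\<close>

text \<open>
  Isomorphisms of digraphs also carry a map of arcs and the head and tail functions of the image;
  for graphs with pairs as arcs these are determined by the map of vertices.
\<close>

lemma digraph_iso_of_bijection:
  assumes G: "parcs G \<subseteq> pverts G \<times> pverts G" and H: "parcs H \<subseteq> pverts H \<times> pverts H"
    and f: "bij_betw f (pverts G) (pverts H)"
    and arcs: "\<And>u v. u \<in> pverts G \<Longrightarrow> v \<in> pverts G \<Longrightarrow> (f u, f v) \<in> parcs H \<longleftrightarrow> (u, v) \<in> parcs G"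
  shows "digraph_iso (with_proj G) (with_proj H)"
proof -
  define h where "h = \<lparr>iso_verts = f, iso_arcs = map_prod f f, iso_head = snd, iso_tail = fst\<rparr>"
  have inj: "inj_on f (pverts G)" and img: "f ` pverts G = pverts H"
    using f by (auto simp: bij_betw_def)
  have "wf_digraph (with_proj G)"
    using G by unfold_locales auto
  moreover have "inj_on (map_prod f f) (parcs G)"
    using map_prod_inj_on[OF inj inj] G inj_on_subset by blast
  ultimately have "pre_digraph.digraph_isomorphism (with_proj G) h"
    unfolding pre_digraph.digraph_isomorphism_def using inj by (simp add: h_def)
  moreover have "map_prod f f ` parcs G = parcs H"
  proof
    show "map_prod f f ` parcs G \<subseteq> parcs H" using G arcs by auto
    show "parcs H \<subseteq> map_prod f f ` parcs G"
    proof
      fix e assume e: "e \<in> parcs H"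
      then have "e \<in> f ` pverts G \<times> f ` pverts G" using H img by blast
      then obtain u v where "e = (f u, f v)" "u \<in> pverts G" "v \<in> pverts G" by auto
      then show "e \<in> map_prod f f ` parcs G" using e arcs by force
    qed
  qed
  then have "with_proj H = app_iso h (with_proj G)"
    by (simp add: app_iso_def with_proj_def h_def img)
  ultimately show ?thesis unfolding digraph_iso_def by blast
qed

lemma parcs_graph_join:
  "(Inl u, Inl v) \<in> parcs (graph_join G H) \<longleftrightarrow> (u, v) \<in> parcs G"
  "(Inr x, Inr y) \<in> parcs (graph_join G H) \<longleftrightarrow> (x, y) \<in> parcs H"
  "(Inl u, Inr y) \<in> parcs (graph_join G H) \<longleftrightarrow> u \<in> pverts G \<and> y \<in> pverts H"
  "(Inr y, Inl u) \<in> parcs (graph_join G H) \<longleftrightarrow> u \<in> pverts G \<and> y \<in> pverts H"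
  by (auto simp: graph_join_def disjoint_union_def)

lemma parcs_disjoint_union:
  "(Inl u, Inl v) \<in> parcs (disjoint_union G H) \<longleftrightarrow> (u, v) \<in> parcs G"
  "(Inr x, Inr y) \<in> parcs (disjoint_union G H) \<longleftrightarrow> (x, y) \<in> parcs H"
  "(Inl u, Inr y) \<notin> parcs (disjoint_union G H)"
  "(Inr y, Inl u) \<notin> parcs (disjoint_union G H)"
  by (auto simp: disjoint_union_def)

lemma pverts_graph_join [simp]: "pverts (graph_join G H) = pverts G <+> pverts H"
  and pverts_disjoint_union [simp]: "pverts (disjoint_union G H) = pverts G <+> pverts H"
  by (simp_all add: graph_join_def disjoint_union_def)

lemma parcs_graph_join_sub:
  assumes "parcs G \<subseteq> pverts G \<times> pverts G" "parcs H \<subseteq> pverts H \<times> pverts H"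
  shows "parcs (graph_join G H) \<subseteq> pverts (graph_join G H) \<times> pverts (graph_join G H)"
  using assms by (auto simp: graph_join_def disjoint_union_def)

lemma bij_betw_Plus:
  assumes "bij_betw f A A'" "bij_betw g B B'" "A \<inter> B = {}"
  shows "bij_betw (\<lambda>v. if v \<in> A then Inl (f v) else Inr (g v)) (A \<union> B) (A' <+> B')"
proof -
  have "bij_betw (\<lambda>v. if v \<in> A then Inl (f v) else Inr (g v)) A (Inl ` A')"
    using bij_betw_trans[OF assms(1), of Inl "Inl ` A'"]
    by (auto simp: bij_betw_def inj_on_def)
  moreover have "bij_betw (\<lambda>v. if v \<in> A then Inl (f v) else Inr (g v)) B (Inr ` B')"
  proof -
    have "bij_betw (Inr \<circ> g) B (Inr ` B')"
      by (rule bij_betw_trans[OF assms(2)]) (simp add: bij_betw_def)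
    then show ?thesis
      by (rule bij_betw_cong[THEN iffD1, rotated]) (use assms(3) in auto)
  qed
  ultimately show ?thesis
    unfolding Plus_def by (intro bij_betw_combine) auto
qed

text \<open>
  Recognises a join inside a given graph: all exceptional graphs of the theorem are identified in
  this way.
\<close>

lemma digraph_iso_graph_join:
  assumes "parcs G \<subseteq> pverts G \<times> pverts G"
    and "parcs H \<subseteq> pverts H \<times> pverts H" and "parcs K \<subseteq> pverts K \<times> pverts K"
    and V: "pverts G = A \<union> B" "A \<inter> B = {}"
    and f: "bij_betw f A (pverts H)" and g: "bij_betw g B (pverts K)"
    and A: "\<And>u v. u \<in> A \<Longrightarrow> v \<in> A \<Longrightarrow> (f u, f v) \<in> parcs H \<longleftrightarrow> (u, v) \<in> parcs G"
    and B: "\<And>u v. u \<in> B \<Longrightarrow> v \<in> B \<Longrightarrow> (g u, g v) \<in> parcs K \<longleftrightarrow> (u, v) \<in> parcs G"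
    and AB: "\<And>u v. u \<in> A \<Longrightarrow> v \<in> B \<Longrightarrow> (u, v) \<in> parcs G \<and> (v, u) \<in> parcs G"
  shows "digraph_iso (with_proj G) (with_proj (graph_join H K))"
proof (rule digraph_iso_of_bijection)
  show "bij_betw (\<lambda>v. if v \<in> A then Inl (f v) else Inr (g v)) (pverts G) (pverts (graph_join H K))"
    using bij_betw_Plus[OF f g V(2)] V(1) by simp
  fix u v assume uv: "u \<in> pverts G" "v \<in> pverts G"
  have "f w \<in> pverts H" if "w \<in> A" for w using f that by (auto simp: bij_betw_def)
  moreover have "g w \<in> pverts K" if "w \<in> B" for w using g that by (auto simp: bij_betw_def)
  ultimately show "(if u \<in> A then Inl (f u) else Inr (g u), if v \<in> A then Inl (f v) else Inr (g v))
      \<in> parcs (graph_join H K) \<longleftrightarrow> (u, v) \<in> parcs G"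
    using uv A B AB V by (auto simp: parcs_graph_join)
qed (rule assms(1) parcs_graph_join_sub[OF assms(2,3)])+

lemma out_degree_eq_card_Image: "out_degree (with_proj G) v = card (parcs G `` {v})"
proof -
  have "out_arcs (with_proj G) v = Pair v ` (parcs G `` {v})"
    by (auto simp: out_arcs_def)
  then show ?thesis by (simp add: out_degree_def card_image inj_on_def)
qed

lemma min_degree_le_card_Image:
  assumes "finite (pverts G)" "v \<in> pverts G"
  shows "min_degree G \<le> card (parcs G `` {v})"
  using assms unfolding min_degree_def out_degree_eq_card_Image by (intro Min_le) auto

text \<open>
  The factors of the joins in \<open>ES n\<close> have natural numbers as vertices, so parts of a graph have to be
  relabelled before they can serve as factors of a join.
\<close>

lemma induced_subgraph_copy:
  assumes G: "pair_graph G" and U: "U \<subseteq> pverts G"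
  obtains H :: "nat pair_pre_digraph" and f where "pair_graph H" "bij_betw f U (pverts H)"
    and "\<And>u v. u \<in> U \<Longrightarrow> v \<in> U \<Longrightarrow> (f u, f v) \<in> parcs H \<longleftrightarrow> (u, v) \<in> parcs G"
    and "\<And>u. u \<in> U \<Longrightarrow> out_degree (with_proj H) (f u) = card (parcs G `` {u} \<inter> U)"
proof -
  interpret G: pair_graph G by (rule G)
  have finU: "finite U" using U G.pair_finite_verts finite_subset by blast
  obtain f where f: "bij_betw f U {0..<card U}"
    using ex_bij_betw_finite_nat[OF finU] by blast
  then have inj: "inj_on f U" and img: "f ` U = {0..<card U}" by (auto simp: bij_betw_def)
  define H where "H = \<lparr>pverts = {0..<card U}, parcs = map_prod f f ` (parcs G \<inter> U \<times> U)\<rparr>"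
  have arcs: "(f u, f v) \<in> parcs H \<longleftrightarrow> (u, v) \<in> parcs G" if "u \<in> U" "v \<in> U" for u v
    using that inj by (auto simp: H_def inj_on_eq_iff)
  have sym: "sym (parcs G)" using G.pair_sym_arcs by (simp add: symmetric_def)
  have fU: "f u < card U" if "u \<in> U" for u using img that by auto
  have "pair_graph H"
  proof
    show "fst e \<in> pverts H" "snd e \<in> pverts H" "fst e \<noteq> snd e" if e: "e \<in> parcs H" for e
    proof -
      obtain u v where "e = (f u, f v)" "(u, v) \<in> parcs G" "u \<in> U" "v \<in> U"
        using e by (auto simp: H_def)
      then show "fst e \<in> pverts H" "snd e \<in> pverts H" "fst e \<noteq> snd e"
        using fU G.no_loops' inj_on_eq_iff[OF inj] by (auto simp: H_def)
    qed
    show "finite (pverts H)" "finite (parcs H)"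
      using G.pair_finite_arcs by (simp_all add: H_def)
    have "sym (parcs H)"
    proof (rule symI)
      fix x y assume "(x, y) \<in> parcs H"
      then obtain u v where "x = f u" "y = f v" "(u, v) \<in> parcs G" "u \<in> U" "v \<in> U"
        by (auto simp: H_def)
      then show "(y, x) \<in> parcs H" using arcs sym by (auto dest: symD)
    qed
    then show "symmetric (with_proj H)" by (simp add: symmetric_def)
  qed
  moreover have "bij_betw f U (pverts H)" using f by (simp add: H_def)
  moreover have "out_degree (with_proj H) (f u) = card (parcs G `` {u} \<inter> U)" if u: "u \<in> U" for u
  proof -
    have "parcs H `` {f u} = f ` (parcs G `` {u} \<inter> U)"
      using u inj by (auto simp: H_def inj_on_eq_iff image_iff)
    moreover have "inj_on f (parcs G `` {u} \<inter> U)" using inj inj_on_subset by blast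
    ultimately show ?thesis by (simp add: out_degree_eq_card_Image card_image)
  qed
  ultimately show thesis using that arcs by blast
qed

text \<open>
  The complement of \<open>K\<^sub>s\<^sub>,\<^sub>t\<close> and two isolated vertices \<open>a\<close>, \<open>b\<close> is \<open>(K\<^sub>s + K\<^sub>t) \<or> K\<^sub>2\<close>. If the complement
  also has the edge \<open>ab\<close>, the second factor becomes \<open>O\<^sub>2\<close>.
\<close>

lemma digraph_iso_bipartite_complement:
  assumes V: "pverts G = (X \<union> Y) \<union> {a, b}" "X \<inter> Y = {}" "a \<notin> X \<union> Y" "b \<notin> X \<union> Y" "a \<noteq> b"
    and fin: "finite X" "finite Y" and card: "card X = s" "card Y = t"
    and G: "parcs G = complete_arcs (pverts G) - C" and C: "sym C"
    and CD: "X \<times> Y \<union> Y \<times> X \<subseteq> C" "C \<subseteq> X \<times> Y \<union> Y \<times> X \<union> {(a, b), (b, a)}"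
  shows "digraph_iso (with_proj G) (with_proj (graph_join
      (disjoint_union (complete_graph s) (complete_graph t)) (complete_graph 2)))
    \<or> digraph_iso (with_proj G) (with_proj (graph_join
      (disjoint_union (complete_graph s) (complete_graph t)) (edgeless_graph 2)))"
proof -
  obtain f where f: "bij_betw f X {0..<s}" using ex_bij_betw_finite_nat[OF fin(1)] card by blast
  obtain g where g: "bij_betw g Y {0..<t}" using ex_bij_betw_finite_nat[OF fin(2)] card by blast
  let ?h = "\<lambda>v. if v \<in> X then Inl (f v) else Inr (g v)"
  let ?U = "disjoint_union (complete_graph s) (complete_graph t)"
  define e :: "'a \<Rightarrow> nat" where "e v = (if v = a then 0 else 1)" for v
  have fg: "f x < s \<and> (x' \<in> X \<longrightarrow> (f x = f x') = (x = x'))" if "x \<in> X" for x x'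
    using f that by (auto simp: bij_betw_def inj_on_eq_iff)
  have gg: "g y < t \<and> (y' \<in> Y \<longrightarrow> (g y = g y') = (y = y'))" if "y \<in> Y" for y y'
    using g that by (auto simp: bij_betw_def inj_on_eq_iff)
  have h: "bij_betw ?h (X \<union> Y) (pverts ?U)"
    using bij_betw_Plus[OF f g V(2)] by (simp add: complete_graph_def lessThan_atLeast0)
  have e: "bij_betw e {a, b} {..<2}"
    using V(5) by (auto simp: bij_betw_def e_def)
  have sub: "parcs G \<subseteq> pverts G \<times> pverts G"
    "parcs ?U \<subseteq> pverts ?U \<times> pverts ?U"
    unfolding G by (auto simp: complete_graph_def disjoint_union_def)
  have C_iff: "(u, v) \<in> C \<longleftrightarrow> (u, v) \<in> X \<times> Y \<union> Y \<times> X" if "u \<in> X \<union> Y" for u v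
    using that CD V(3,4) by auto
  have inner: "(?h u, ?h v) \<in> parcs ?U \<longleftrightarrow> (u, v) \<in> parcs G" if uv: "u \<in> X \<union> Y" "v \<in> X \<union> Y" for u v
  proof -
    have "u \<in> pverts G" "v \<in> pverts G" using uv V(1) by auto
    then have "(u, v) \<in> parcs G \<longleftrightarrow> u \<noteq> v \<and> (u, v) \<notin> X \<times> Y \<union> Y \<times> X"
      unfolding G using C_iff[OF uv(1)] by simp
    then show ?thesis
      using uv V(2) by (cases "u \<in> X"; cases "v \<in> X") (auto simp: parcs_disjoint_union complete_graph_def fg gg)
  qed
  have cross: "(u, v) \<in> parcs G \<and> (v, u) \<in> parcs G" if "u \<in> X \<union> Y" "v \<in> {a, b}" for u v
  proof -
    have "(u, v) \<notin> C" using that C_iff V by auto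
    then have "(v, u) \<notin> C" using C by (auto dest: symD)
    then show ?thesis unfolding G using that V \<open>(u, v) \<notin> C\<close> by auto
  qed
  have split: "(X \<union> Y) \<inter> {a, b} = {}" using V(3,4) by auto
  have ends: "(u, v) \<in> parcs G \<longleftrightarrow> u \<noteq> v \<and> (a, b) \<notin> C" if "u \<in> {a, b}" "v \<in> {a, b}" for u v
  proof -
    have "u \<in> pverts G" "v \<in> pverts G" using that V(1) by auto
    moreover have "(a, b) \<in> C \<longleftrightarrow> (b, a) \<in> C" using C by (auto dest: symD)
    ultimately show ?thesis using that unfolding G by auto
  qed
  have e_iff: "(e u = e v) = (u = v)" if "u \<in> {a, b}" "v \<in> {a, b}" for u v
    using that V(5) by (auto simp: e_def)
  have e_lt: "e u < 2" for u by (simp add: e_def)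
  show ?thesis
  proof (cases "(a, b) \<in> C")
    case True
    have "digraph_iso (with_proj G) (with_proj (graph_join ?U (edgeless_graph 2)))"
    proof (rule digraph_iso_graph_join[OF sub _ V(1) split h _ inner _ cross])
      show "bij_betw e {a, b} (pverts (edgeless_graph 2))"
        using e by (simp add: edgeless_graph_def)
      show "(e u, e v) \<in> parcs (edgeless_graph 2) \<longleftrightarrow> (u, v) \<in> parcs G"
        if "u \<in> {a, b}" "v \<in> {a, b}" for u v
        using ends[OF that] True by (simp add: edgeless_graph_def)
    qed (auto simp: edgeless_graph_def)
    then show ?thesis by simp
  next
    case False
    have "digraph_iso (with_proj G) (with_proj (graph_join ?U (complete_graph 2)))"
    proof (rule digraph_iso_graph_join[OF sub _ V(1) split h _ inner _ cross])
      show "bij_betw e {a, b} (pverts (complete_graph 2))"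
        using e by (simp add: complete_graph_def)
      show "(e u, e v) \<in> parcs (complete_graph 2) \<longleftrightarrow> (u, v) \<in> parcs G"
        if "u \<in> {a, b}" "v \<in> {a, b}" for u v
        using ends[OF that] e_iff[OF that] e_lt False by (simp add: complete_graph_def)
    qed (auto simp: complete_graph_def)
    then show ?thesis by simp
  qed
qed

text \<open>
  Being completely joined to the rest, \<open>I\<close> supplies \<open>r = card I\<close> neighbours to every vertex there and leaves
  degree \<open>k - r\<close> inside the rest; in particular \<open>r \<le> k\<close>. The graph induced on \<open>I\<close> becomes the
  arbitrary factor.
\<close>

lemma digraph_iso_ES:
  assumes G: "pair_graph G" and card: "card (pverts G) = 2 * k"
    and I: "I \<subseteq> pverts G" "I \<noteq> {}" "I \<noteq> pverts G"
    and join: "\<And>u v. u \<in> pverts G - I \<Longrightarrow> v \<in> I \<Longrightarrow> (u, v) \<in> parcs G"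
    and deg: "\<And>u. u \<in> pverts G - I \<Longrightarrow> card (parcs G `` {u}) = k"
  shows "\<exists>H \<in> ES (2 * k). digraph_iso (with_proj G) (with_proj H)"
proof -
  interpret G: pair_graph G by (rule G)
  have fin: "finite (pverts G)" by (rule G.pair_finite_verts)
  have sym: "sym (parcs G)" using G.pair_sym_arcs by (simp add: symmetric_def)
  define U where "U = pverts G - I"
  define r where "r = card I"
  have finI: "finite I" using I(1) fin by (rule finite_subset)
  have finU: "finite U" using fin by (simp add: U_def)
  have cU: "card U = 2 * k - r"
    using card I(1) finI by (simp add: U_def r_def card_Diff_subset)
  obtain G1 :: "nat pair_pre_digraph" and f where G1: "pair_graph G1" and f: "bij_betw f U (pverts G1)"
    and f_arcs: "\<And>u v. u \<in> U \<Longrightarrow> v \<in> U \<Longrightarrow> (f u, f v) \<in> parcs G1 \<longleftrightarrow> (u, v) \<in> parcs G"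
    and f_deg: "\<And>u. u \<in> U \<Longrightarrow> out_degree (with_proj G1) (f u) = card (parcs G `` {u} \<inter> U)"
    by (rule induced_subgraph_copy[OF G, of U]) (use U_def in auto)
  obtain G2 :: "nat pair_pre_digraph" and g where G2: "pair_graph G2" and g: "bij_betw g I (pverts G2)"
    and g_arcs: "\<And>u v. u \<in> I \<Longrightarrow> v \<in> I \<Longrightarrow> (g u, g v) \<in> parcs G2 \<longleftrightarrow> (u, v) \<in> parcs G"
    by (rule induced_subgraph_copy[OF G I(1)]) auto
  have deg_split: "card (parcs G `` {u} \<inter> U) + r = k" if u: "u \<in> U" for u
  proof -
    have "parcs G `` {u} = (parcs G `` {u} \<inter> U) \<union> I"
      using join u G.in_arcsD2 by (auto simp: U_def)
    moreover have "card ((parcs G `` {u} \<inter> U) \<union> I) = card (parcs G `` {u} \<inter> U) + card I"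
      using finU finI by (intro card_Un_disjoint) (auto simp: U_def)
    ultimately have "card (parcs G `` {u}) = card (parcs G `` {u} \<inter> U) + card I"
      by simp
    then show ?thesis using deg u by (simp add: U_def r_def)
  qed
  obtain u where u: "u \<in> U" using I by (auto simp: U_def)
  have r: "1 \<le> r" "r \<le> k"
    using I(2) finI deg_split[OF u] by (auto simp: r_def Suc_le_eq card_gt_0_iff)
  have "regular_graph (k - r) G1"
    unfolding regular_graph_def
  proof (intro conjI ballI G1)
    fix w assume "w \<in> pverts G1"
    then obtain u where u: "u \<in> U" "w = f u" using f by (auto simp: bij_betw_def)
    show "out_degree (with_proj G1) w = k - r"
      using f_deg[OF u(1)] deg_split[OF u(1)] u(2) by simp
  qed
  moreover have "card (pverts G1) = 2 * k - r" "card (pverts G2) = r"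
    using bij_betw_same_card[OF f] bij_betw_same_card[OF g] cU by (simp_all add: r_def)
  ultimately have "graph_join G1 G2 \<in> ES (2 * k)"
    unfolding ES_def using r G2 by auto
  moreover have "digraph_iso (with_proj G) (with_proj (graph_join G1 G2))"
  proof (rule digraph_iso_graph_join[OF _ _ _ _ _ f g f_arcs g_arcs])
    show "parcs G \<subseteq> pverts G \<times> pverts G" using G.wellformed' by auto
    show "parcs G1 \<subseteq> pverts G1 \<times> pverts G1"
      using pair_wf_digraph.wellformed'[of G1] G1
      by (auto simp: pair_graph_def pair_digraph_def pair_fin_digraph_def)
    show "parcs G2 \<subseteq> pverts G2 \<times> pverts G2"
      using pair_wf_digraph.wellformed'[of G2] G2
      by (auto simp: pair_graph_def pair_digraph_def pair_fin_digraph_def)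
    show "pverts G = U \<union> I" "U \<inter> I = {}" using I by (auto simp: U_def)
    show "(u, v) \<in> parcs G \<and> (v, u) \<in> parcs G" if "u \<in> U" "v \<in> I" for u v
      using join[of u v] that sym by (auto simp: U_def dest: symD)
  qed
  ultimately show ?thesis by blast
qed

section \<open>Hamilton-connectedness\<close>

theorem theorem2p12:
  fixes k n :: nat and G :: "'a pair_pre_digraph"
  assumes "k \<ge> 2" and "n \<ge> 2 * k"
    and "pair_graph G" and "card (pverts G) = n"
    and "min_degree G \<ge> k"
    and "graph_spectral_radius (graph_complement G) \<le> sqrt ((real k - 1) * (real n - real k - 1))"
  shows "hamilton_connected G
    \<or> digraph_iso (with_proj G) (with_proj (graph_join
         (disjoint_union (complete_graph (k - 1)) (complete_graph (n - k - 1))) (complete_graph 2)))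
    \<or> digraph_iso (with_proj G) (with_proj (graph_join
         (disjoint_union (complete_graph (k - 1)) (complete_graph (n - k - 1))) (edgeless_graph 2)))
    \<or> (n = 2 * k \<and> (\<exists>H \<in> ES n. digraph_iso (with_proj G) (with_proj H)))"
proof (cases "hamilton_connected G")
  case False
  interpret G: pair_graph G by (rule assms(3))
  define V where "V = pverts G"
  define A where "A = parcs G"
  define C where "C = complete_arcs V - A"
  \<comment> \<open>The extremal degrees in the complement: \<open>M\<close> is the largest degree that the minimum degree of
    \<open>G\<close> permits, and \<open>m + M = n - 2\<close> is the smallest degree sum of an edge of \<open>D\<close>.\<close>
  define m where "m = k - 1"
  define M where "M = n - k - 1"
  define c where "c = sqrt (real m * real M)"
  have mM: "0 < m" "0 < M" "m \<le> M" "n = m + M + 2" using assms(1,2) by (auto simp: m_def M_def)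
  have finV: "finite V" and cardV: "card V = n"
    using G.pair_finite_verts assms(4) by (simp_all add: V_def)
  have AK: "A \<subseteq> complete_arcs V"
    using G.wellformed' G.no_loops' by (auto simp: A_def V_def)
  have symA: "sym A" using G.pair_sym_arcs by (simp add: symmetric_def A_def)
  have compl: "graph_complement G = \<lparr>pverts = V, parcs = C\<rparr>"
    by (auto simp: graph_complement_def V_def C_def A_def)
  have A_eq: "A = complete_arcs V - C" using AK by (auto simp: C_def)
  have CV: "C \<subseteq> V \<times> V" and symC: "sym C" and irrC: "irrefl C"
    using symA by (auto simp: C_def sym_def irrefl_def)
  have minA: "k \<le> card (A `` {v})" if "v \<in> V" for v
    using min_degree_le_card_Image[of G v] finV that assms(5) by (simp add: V_def A_def)
  obtain a b where ab: "a \<in> V" "b \<in> V" "a \<noteq> b" and no: "\<not> has_ham_path V A a b"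
    using False hamiltonian_path_of_has_ham_path[of G] unfolding hamilton_connected_def V_def A_def by blast
  obtain D where DC: "D \<subseteq> C" and D_sym: "sym D" and neD: "D \<noteq> {}"
    and sum_ge: "\<And>u v. (u, v) \<in> D \<Longrightarrow> n \<le> card (D `` {u}) + card (D `` {v}) + 2"
    and sum_gt: "\<And>v. (a, v) \<in> D \<Longrightarrow> n < card (D `` {a}) + card (D `` {v}) + 2"
      "\<And>v. (b, v) \<in> D \<Longrightarrow> n < card (D `` {b}) + card (D `` {v}) + 2"
    and deg_le: "\<And>u. u \<in> V \<Longrightarrow> card (D `` {u}) + k + 1 \<le> n"
    by (rule complement_of_maximal_without_ham_path
        [OF finV AK symA no minA ab, folded C_def, unfolded cardV]) blast+
  have DV: "D \<subseteq> V \<times> V" using DC CV by blast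
  have c: "c > 0" "c\<^sup>2 = real (m * M)" using mM by (simp_all add: c_def)
  have "sqrt ((real k - 1) * (real n - real k - 1)) = c"
    using assms(1,2) by (simp add: c_def m_def M_def of_nat_diff)
  then have rho: "graph_spectral_radius (graph_complement G) \<le> c" using assms(6) by simp
  have Rayleigh: "(\<Sum>(u, v)\<in>C. y u * y v) \<le> c * (\<Sum>v\<in>V. (y v)\<^sup>2)" for y
  proof -
    have "(\<Sum>(u, v)\<in>C. y u * y v) \<le> graph_spectral_radius (graph_complement G) * (\<Sum>v\<in>V. (y v)\<^sup>2)"
      using graph_spectral_radius_Rayleigh[of "graph_complement G" y] finV ab(1) CV symC
      unfolding compl by auto
    also have "\<dots> \<le> c * (\<Sum>v\<in>V. (y v)\<^sup>2)"
      by (intro mult_right_mono rho sum_nonneg) simp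
    finally show ?thesis .
  qed
  have bounds: "card (D `` {u}) \<le> M" "card (D `` {v}) \<le> M" "m + M \<le> card (D `` {u}) + card (D `` {v})"
    if "(u, v) \<in> D" for u v
  proof -
    have "u \<in> V" "v \<in> V" using that DV by auto
    then show "card (D `` {u}) \<le> M" "card (D `` {v}) \<le> M"
      using deg_le[of u] deg_le[of v] unfolding M_def by linarith+
    show "m + M \<le> card (D `` {u}) + card (D `` {v})"
      using sum_ge[OF that] mM(4) by linarith
  qed
  note test = degree_weighted_test_vector[OF finV CV symC DC c(1) Rayleigh]
  have ge: "c\<^sup>2 \<le> real (card (D `` {u})) * real (card (D `` {v}))" if "(u, v) \<in> D" for u v
    using product_of_bounded_pair(1)[OF bounds[OF that]] unfolding c(2) by (simp flip: of_nat_mult)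
  have extra: "D `` {u} = {} \<and> D `` {v} = {}" if "(u, v) \<in> C - D" for u v
    using test(2)[OF ge that] .
  have edge: "card (D `` {u}) = M \<and> card (D `` {v}) = m \<or> card (D `` {u}) = m \<and> card (D `` {v}) = M"
    if "(u, v) \<in> D" for u v
  proof -
    have "card (D `` {u}) * card (D `` {v}) = m * M"
      using test(1)[OF ge that] unfolding c(2) by (simp flip: of_nat_mult)
    then show ?thesis by (rule product_of_bounded_pair(2)[OF bounds[OF that] _ mM(2)])
  qed
  \<comment> \<open>All degree sums are minimal, which the strict bound at \<open>a\<close> and \<open>b\<close> excludes.\<close>
  have "(a, v) \<notin> D" "(b, v) \<notin> D" for v
    using edge[of a v] edge[of b v] sum_gt(1)[of v] sum_gt(2)[of v] mM(4) by linarith+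
  then have isolated: "D `` {a} = {}" "D `` {b} = {}"
    by auto
  show ?thesis
  proof (cases "m < M")
    case True
    obtain X Y where XY: "V = (X \<union> Y) \<union> {a, b}" "X \<inter> Y = {}" "a \<notin> X \<union> Y" "b \<notin> X \<union> Y"
      and cXY: "card X = m" "card Y = M" and D: "D = X \<times> Y \<union> Y \<times> X"
      by (rule two_degree_complete_bipartite[OF finV DV neD ab isolated
            cardV[unfolded mM(4)] mM(1) True edge]) blast
    have "C \<subseteq> D \<union> {(a, b), (b, a)}"
    proof
      fix e assume e: "e \<in> C"
      obtain u v where uv: "e = (u, v)" by (cases e)
      show "e \<in> D \<union> {(a, b), (b, a)}"
      proof (cases "e \<in> D")
        case False
        then have "D `` {u} = {}" "D `` {v} = {}" using extra e uv by auto
        moreover have "X \<noteq> {}" "Y \<noteq> {}" using cXY mM by auto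
        moreover have "D `` {x} \<noteq> {}" if "x \<in> X \<union> Y" for x
        proof -
          obtain x' y' where "x' \<in> X" "y' \<in> Y" using \<open>X \<noteq> {}\<close> \<open>Y \<noteq> {}\<close> by blast
          then have "(x, x') \<in> D \<or> (x, y') \<in> D" using that unfolding D by blast
          then show ?thesis by blast
        qed
        ultimately have "u \<notin> X \<union> Y" "v \<notin> X \<union> Y" by blast+
        moreover have "u \<in> V" "v \<in> V" "u \<noteq> v" using e uv CV irrC by (auto simp: irrefl_def)
        ultimately show ?thesis using XY(1) uv by auto
      qed simp
    qed
    moreover have "finite X" "finite Y" using finV XY(1) by auto
    ultimately have "digraph_iso (with_proj G) (with_proj (graph_join
        (disjoint_union (complete_graph m) (complete_graph M)) (complete_graph 2)))
      \<or> digraph_iso (with_proj G) (with_proj (graph_join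
        (disjoint_union (complete_graph m) (complete_graph M)) (edgeless_graph 2)))"
      using XY ab(3) cXY A_eq symC DC
      by (intro digraph_iso_bipartite_complement[where X = X and Y = Y and a = a and b = b and C = C])
        (simp_all add: V_def A_def D)
    then show ?thesis unfolding m_def M_def by blast
  next
    case False
    then have eq: "M = m" using mM(3) by linarith
    then have n: "n = 2 * k" using mM(4) m_def assms(1) by linarith
    \<comment> \<open>Now \<open>D\<close> is regular apart from its isolated vertices, among which \<open>C\<close> may have further edges.\<close>
    define I where "I = {v \<in> V. D `` {v} = {}}"
    have CD: "C `` {u} = D `` {u}" if "u \<in> V - I" for u
    proof -
      have "D `` {u} \<noteq> {}" using that by (simp add: I_def)
      then have "(u, v) \<in> D" if "(u, v) \<in> C" for v using extra[of u v] that by blast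
      then show ?thesis using DC by blast
    qed
    have "\<exists>H \<in> ES (2 * k). digraph_iso (with_proj G) (with_proj H)"
    proof (rule digraph_iso_ES[OF assms(3), of k I])
      show "card (pverts G) = 2 * k" using assms(4) n by simp
      show "I \<subseteq> pverts G" by (auto simp: I_def V_def)
      show "I \<noteq> {}" using ab isolated by (auto simp: I_def)
      show "I \<noteq> pverts G" using neD DV by (auto simp: I_def V_def)
      show "(u, v) \<in> parcs G" if "u \<in> pverts G - I" "v \<in> I" for u v
      proof -
        have "(v, u) \<notin> D" using that by (auto simp: I_def)
        then have "(u, v) \<notin> D" using D_sym by (auto dest: symD)
        then have "(u, v) \<notin> C" using CD[of u] that by (auto simp: V_def)
        then show ?thesis
          using that C_def by (auto simp: A_def I_def V_def)
      qed
      show "card (parcs G `` {u}) = k" if u: "u \<in> pverts G - I" for u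
      proof -
        obtain v where "(u, v) \<in> D" using u by (auto simp: I_def V_def)
        then have "card (D `` {u}) = m" using edge[of u v] eq by blast
        then have "card (C `` {u}) = m" using CD[of u] u by (simp add: V_def)
        moreover have "card (A `` {u}) + card (C `` {u}) + 1 = n"
          using card_complete_arcs_diff[OF finV AK, of u, folded C_def] u assms(4) by (simp add: V_def)
        ultimately have "card (A `` {u}) = k" using mM(4) eq assms(1) m_def by linarith
        then show ?thesis by (simp add: A_def)
      qed
    qed
    then show ?thesis using n by simp
  qed
qed simp

end
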